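(* Let $a>0$ and $X$ be given real numbers with $-\sqrt a<X<\sqrt a$. Let $E=E(b)$ be the function of $b\in\,]-\infty,0[$ and $P=P(b)$ the polynomial defined in the context. Below, "solution of $E=0$" means a solution $b\in\,]-\infty,0[$. (a) If $X\le-\sqrt{15/8}$, then $P$ has exactly two negative zeros $\widetilde b_1<\widetilde b_2$. Moreover, $\widetilde b_1<b_1$, and $E=0$ has exactly two solutions, one in $]\widetilde b_1,b_1[$ and the other in $]b_2,0[$, where $$b_1=\frac{4X}{5}-\frac15\sqrt{16X^2-30},\qquad b_2=\frac{4X}{5}+\frac15\sqrt{16X^2-30}.$$ (b) If $-\sqrt{15/8}<X<0$, the equation $E=0$ has solutions only if $P$ has two negative zeros $\widetilde b_1<\widetilde b_2$. In that case: if $E(\widetilde b_2)=0$, then $\widetilde b_2$ is the only solution of $E=0$; if $E(\widetilde b_2)<0$, then $E=0$ has exactly two solutions, which lie in the intervals $]\widetilde b_1,\widetilde b_2[$ and $]\widetilde b_2,0[$; if $E(\widetilde b_2)>0$, then $E=0$ has no solution. (c) If $X=0$, the equation $E=0$ has no solution for $a\le 21/10$. If $X=0$ and $a>21/10$, then $E=0$ has exactly one solution, which lies in $]\widetilde b_1,0[$, where $\widetilde b_1$ is the negative zero of $P$. (d) If $X>0$, then $P$ has exactly one negative zero $\widetilde b_1$, and $E=0$ has exactly one solution, which lies in $]\widetilde b_1,0[$.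
   Context: For $a>0$, $-\sqrt a<X<\sqrt a$ and $b<0$ put $$A=a-X^2>0,\qquad a'=\frac{b^2}{4}-bX+a,\qquad X'=X-\frac b2 ,$$ $$V_2=\frac{a'^2}{2}\left(\frac{\pi}{2}-\arctan\frac{X'}{\sqrt A}\right)+\frac{2X'^3-5a'X'}{6}\sqrt A,$$ $$E=E(b)=\left(\frac{5b^2}{12}-\frac{2bX}{3}+\frac12\right)V_2+\frac{2b}{9}A^{5/2},$$ $$P=P(b)=6X\,b^3+(-10a+21)\,b^2-36X\,b+12a+18 .$$ Here $]u,v[$ denotes the open interval. ($E=0$ is the equilibrium condition for a paraboloid segment $\{x^2+y^2\le z\le a\}$ floating in a fluid with surface $\{z=a+b(x-X)\}$.) *)

theory Defs
  imports "HOL-Analysis.Analysis"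
begin

text \<open>
  The equilibrium function of a floating paraboloid segment, as a function of the slope \<open>b\<close> of
  the fluid surface. All functions are total in \<open>a\<close>, \<open>X\<close>, \<open>b\<close>; they have their intended meaning
  for \<open>a > 0\<close>, \<open>- sqrt a < X < sqrt a\<close> and \<open>b < 0\<close>, where in particular \<open>A_par a X > 0\<close>.
\<close>

definition A_par :: "real \<Rightarrow> real \<Rightarrow> real" where
  "A_par a X = a - X\<^sup>2"

definition a_prime :: "real \<Rightarrow> real \<Rightarrow> real \<Rightarrow> real" where
  "a_prime a X b = b\<^sup>2 / 4 - b * X + a"

definition X_prime :: "real \<Rightarrow> real \<Rightarrow> real" where
  "X_prime X b = X - b / 2"

definition V2 :: "real \<Rightarrow> real \<Rightarrow> real \<Rightarrow> real" where
  "V2 a X b =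
     (a_prime a X b)\<^sup>2 / 2 * (pi / 2 - arctan (X_prime X b / sqrt (A_par a X)))
     + (2 * X_prime X b ^ 3 - 5 * a_prime a X b * X_prime X b) / 6 * sqrt (A_par a X)"

definition E :: "real \<Rightarrow> real \<Rightarrow> real \<Rightarrow> real" where
  "E a X b = (5 * b\<^sup>2 / 12 - 2 * b * X / 3 + 1 / 2) * V2 a X b
             + 2 * b / 9 * A_par a X powr (5 / 2)"

definition P :: "real \<Rightarrow> real \<Rightarrow> real \<Rightarrow> real" where
  "P a X b = 6 * X * b ^ 3 + (- 10 * a + 21) * b\<^sup>2 - 36 * X * b + 12 * a + 18"

definition E_solutions :: "real \<Rightarrow> real \<Rightarrow> real set" where
  "E_solutions a X = {b. b < 0 \<and> E a X b = 0}"

definition P_neg_zeros :: "real \<Rightarrow> real \<Rightarrow> real set" where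
  "P_neg_zeros a X = {b. b < 0 \<and> P a X b = 0}"

definition b1 :: "real \<Rightarrow> real" where
  "b1 X = 4 * X / 5 - 1 / 5 * sqrt (16 * X\<^sup>2 - 30)"

definition b2 :: "real \<Rightarrow> real" where
  "b2 X = 4 * X / 5 + 1 / 5 * sqrt (16 * X\<^sup>2 - 30)"

end

theory Submission
  imports Defs "HOL-Real_Asymp.Real_Asymp"
begin

text \<open>
  Put \<open>q b = 5 b\<^sup>2 / 12 - 2 b X / 3 + 1 / 2\<close>, so that
  \<open>E = q V\<^sub>2 + (2 b / 9) A\<^bsup>5/2\<^esup>\<close>. Dividing by \<open>q a'\<^sup>2\<close> isolates the arctangent: the
  quotient \<open>G = E / (q a'\<^sup>2)\<close> is the sum of \<open>V\<^sub>2 / a'\<^sup>2\<close>, in which the arctangent has a constant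
  factor, and a rational function. Differentiation therefore removes everything transcendental,
  and what remains is
  \<open>G' = A\<^bsup>5/2\<^esup> P / (108 a'\<^sup>3 q\<^sup>2)\<close> (lemma \<open>has_real_derivative_G\<close>). So \<open>P\<close> governs the monotonicity of
  \<open>G\<close>, while \<open>E\<close> and \<open>G\<close> have the same sign wherever \<open>q > 0\<close>.

  The boundary values are known: \<open>G\<close> tends to \<open>0\<close> as \<open>b\<close> tends to minus infinity, and \<open>E 0 > 0\<close>. The
  latter rests on \<open>V\<^sub>2 > 0\<close>, which holds because \<open>V\<^sub>2 / a'\<^sup>2\<close> also tends to \<open>0\<close> at minus infinity and
  has derivative \<open>2 A\<^bsup>5/2\<^esup> / (3 a'\<^sup>3) > 0\<close>. Where \<open>q \<le> 0\<close>, positivity of \<open>V\<^sub>2\<close> gives \<open>E < 0\<close>, so there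
  are no solutions there.

  It remains to know the sign of \<open>P\<close> on the negative axis. For \<open>X \<ge> 0\<close> a negative zero is unique and
  \<open>P\<close> passes there from negative to positive: \<open>G\<close> falls from \<open>0\<close>, then rises to a positive value, and
  vanishes once. For \<open>X < 0\<close> and two negative zeros, the third zero is positive and \<open>P\<close> is positive,
  negative, positive. If \<open>q\<close> has no negative zero (\<open>X\<^sup>2 < 15/8\<close>), \<open>G\<close> rises from \<open>0\<close>, falls to a local
  minimum at the larger zero, and rises again, so the value there decides. If \<open>q\<close> vanishes at
  \<open>b\<^sub>1 \<le> b\<^sub>2\<close>, then \<open>E < 0\<close> on \<open>[b\<^sub>1, b\<^sub>2]\<close>. This forces \<open>P\<close> to take a
  negative value left of \<open>b\<^sub>1\<close>, hence to have two negative zeros, and \<open>P b\<^sub>1 \<le> 0 \<le> P b\<^sub>2\<close> shows that the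
  larger one lies in this interval, so \<open>E\<close> changes sign exactly once on each side of it.
\<close>

section \<open>Functions vanishing at minus infinity\<close>

lemma pos_if_increasing_from_zero_at_bot:
  fixes f :: "real \<Rightarrow> real"
  assumes lim: "(f \<longlongrightarrow> 0) at_bot"
    and cont: "continuous_on {..v} f"
    and deriv: "\<And>x. x < v \<Longrightarrow> \<exists>y. (f has_real_derivative y) (at x) \<and> y > 0"
  shows "f v > 0"
proof -
  have incr: "f x < f y" if xy: "x < y" "y \<le> v" for x y
  proof (rule DERIV_pos_imp_increasing_open[OF xy(1)])
    show "continuous_on {x..y} f"
      using xy by (auto intro: continuous_on_subset[OF cont])
  qed (use deriv xy in simp)
  have "eventually (\<lambda>x. f x \<le> f (v - 1)) at_bot"
    using eventually_gt_at_bot[of "v - 1"]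
    by eventually_elim (use incr in force)
  hence "0 \<le> f (v - 1)"
    by (intro tendsto_upperbound[OF lim]) simp_all
  thus ?thesis
    using incr[of "v - 1" v] by simp
qed

section \<open>The normalised equilibrium function\<close>

definition q :: "real \<Rightarrow> real \<Rightarrow> real" where
  "q X b = 5 * b\<^sup>2 / 12 - 2 * b * X / 3 + 1 / 2"

text \<open>
  At a zero of \<open>q\<close> the function \<open>G\<close> takes the default value \<open>0\<close> of division by zero; it is only meaningful
  elsewhere.
\<close>

definition G :: "real \<Rightarrow> real \<Rightarrow> real \<Rightarrow> real" where
  "G a X b = E a X b / (q X b * (a_prime a X b)\<^sup>2)"

lemma q_pos_if_nonneg: "0 \<le> X \<Longrightarrow> b \<le> 0 \<Longrightarrow> q X b > 0"
  using mult_nonpos_nonneg[of b X] zero_le_power2[of b] unfolding q_def by linarith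

lemma q_pos_if_small:
  assumes "X\<^sup>2 < 15 / 8"
  shows "q X b > 0"
proof -
  have "q X b = 5 / 12 * (b - 4 * X / 5)\<^sup>2 + (15 / 8 - X\<^sup>2) * (4 / 15)"
    by (simp add: q_def power2_eq_square algebra_simps)
  thus ?thesis using assms by (simp add: add_nonneg_pos)
qed

text \<open>
  This is where \<open>b\<^sub>1\<close> and \<open>b\<^sub>2\<close> come from. The hypothesis makes the radicand nonnegative.
\<close>

lemma q_factorisation:
  assumes "15 / 8 \<le> X\<^sup>2"
  shows "q X b = 5 / 12 * (b - b1 X) * (b - b2 X)"
proof -
  have s: "sqrt (16 * X\<^sup>2 - 30) * sqrt (16 * X\<^sup>2 - 30) = 16 * X\<^sup>2 - 30"
    using assms by simp
  have "5 / 12 * (b - b1 X) * (b - b2 X)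
      = 5 / 12 * ((b - 4 * X / 5)\<^sup>2 - sqrt (16 * X\<^sup>2 - 30) * sqrt (16 * X\<^sup>2 - 30) / 25)"
    by (simp add: b1_def b2_def power2_eq_square algebra_simps)
  also have "\<dots> = q X b"
    unfolding s by (simp add: q_def power2_eq_square field_simps)
  finally show ?thesis by simp
qed

text \<open>
  At a zero of \<open>q\<close> only the first summand survives, so when \<open>a' > 0\<close> the sign of \<open>P\<close>
  there is that of \<open>6 / 5 - b\<^sup>2\<close>. The two cofactors are \<open>q - b q'\<close> and \<open>3 q - 2 b (b / 2 - X)\<close>; in this form
  \<open>P\<close> appears as the numerator of the derivative of \<open>G\<close>.
\<close>

lemma P_eq_q:
  "P a X b = 24 * (a_prime a X b * (1 / 2 - 5 * b\<^sup>2 / 12) + q X b * (b\<^sup>2 / 4 + 3 / 2))"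
  by (simp add: P_def a_prime_def q_def power2_eq_square power3_eq_cube field_simps)

lemma continuous_on_E: "continuous_on S (E a X)"
  unfolding E_def[abs_def] V2_def a_prime_def X_prime_def divide_inverse
  by (intro continuous_intros)

lemma continuous_on_P: "continuous_on S (P a X)"
  unfolding P_def[abs_def] by (intro continuous_intros)

context
  fixes a X :: real
  assumes inside: "X\<^sup>2 < a"
begin

lemma A_pos: "A_par a X > 0"
  using inside by (simp add: A_par_def)

lemma a_prime_eq: "a_prime a X b = (X_prime X b)\<^sup>2 + A_par a X"
  by (simp add: a_prime_def X_prime_def A_par_def power2_eq_square algebra_simps)

lemma a_prime_pos: "a_prime a X b > 0"
  using A_pos by (simp add: a_prime_eq add_nonneg_pos)

lemma A_powr: "A_par a X powr (5 / 2) = sqrt (A_par a X) ^ 5"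
proof -
  have "sqrt (A_par a X) ^ 5 = (A_par a X powr (1/2)) powr 5"
    using A_pos by (simp add: powr_half_sqrt powr_realpow)
  thus ?thesis by (simp add: powr_powr)
qed

lemma E_eq: "E a X b = q X b * V2 a X b + 2 * b / 9 * A_par a X powr (5 / 2)"
  by (simp add: E_def q_def)

text \<open>
  With \<open>A = s\<^sup>2\<close> and \<open>x = X'\<close> one has \<open>a' = x\<^sup>2 + s\<^sup>2\<close>, so \<open>V\<^sub>2 / a'\<^sup>2\<close> is a function \<open>w\<close> of \<open>x\<close>
  alone, and all powers of \<open>x\<close> cancel in the numerator of \<open>w'\<close>.
\<close>

lemma has_real_derivative_V2_normalised:
  "((\<lambda>b. V2 a X b / (a_prime a X b)\<^sup>2) has_real_derivative
      2 * A_par a X powr (5 / 2) / (3 * a_prime a X b ^ 3)) (at b)"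
proof -
  define s where "s = sqrt (A_par a X)"
  have s: "s > 0" "A_par a X = s\<^sup>2" using A_pos by (auto simp: s_def)
  define w where "w = (\<lambda>x. (pi / 2 - arctan (x / s)) / 2
      + (2 * x ^ 3 - 5 * (x\<^sup>2 + s\<^sup>2) * x) / 6 * s / (x\<^sup>2 + s\<^sup>2)\<^sup>2)"
  have nz: "x\<^sup>2 + s\<^sup>2 \<noteq> 0" for x :: real
    using s(1) by (simp add: sum_power2_eq_zero_iff)
  have at_deriv: "1 / (1 + (x / s)\<^sup>2) / s = s / (x\<^sup>2 + s\<^sup>2)" for x
  proof -
    have "1 + (x / s)\<^sup>2 = (x\<^sup>2 + s\<^sup>2) / s\<^sup>2"
      using s(1) by (simp add: field_simps)
    thus ?thesis using s(1) by (simp add: power2_eq_square)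
  qed
  have dw: "(w has_real_derivative - 4 * s ^ 5 / (3 * (x\<^sup>2 + s\<^sup>2) ^ 3)) (at x)" for x
  proof -
    have d1: "((\<lambda>x. arctan (x / s)) has_real_derivative s / (x\<^sup>2 + s\<^sup>2)) (at x)"
    proof -
      have "((\<lambda>x. arctan (x / s)) has_real_derivative inverse (1 + (x / s)\<^sup>2) * (1 / s)) (at x)"
        by (intro DERIV_chain2[OF DERIV_arctan] DERIV_cdivide DERIV_ident)
      thus ?thesis using at_deriv[of x] by (simp add: field_simps)
    qed
    have d2: "((\<lambda>x. 2 * x ^ 3 - 5 * (x\<^sup>2 + s\<^sup>2) * x) has_real_derivative
        - 9 * x\<^sup>2 - 5 * s\<^sup>2) (at x)"
      by (rule derivative_eq_intros refl)+ (simp add: power2_eq_square algebra_simps)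
    have d3: "((\<lambda>x. (x\<^sup>2 + s\<^sup>2)\<^sup>2) has_real_derivative 4 * x * (x\<^sup>2 + s\<^sup>2)) (at x)"
      by (rule derivative_eq_intros refl)+ (simp add: power2_eq_square algebra_simps)
    define D where "D = x\<^sup>2 + s\<^sup>2"
    have D: "D \<noteq> 0" using nz by (simp add: D_def)
    have "(w has_real_derivative (0 - s / D) / 2
        + ((- 9 * x\<^sup>2 - 5 * s\<^sup>2) / 6 * s * D\<^sup>2
            - (2 * x ^ 3 - 5 * D * x) / 6 * s * (4 * x * D)) / (D\<^sup>2 * D\<^sup>2)) (at x)"
      unfolding w_def D_def
      by (intro DERIV_add DERIV_diff DERIV_divide DERIV_cdivide DERIV_cmult_right DERIV_const d1 d2 d3)
         (use nz[of x] in simp)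
    also have "(0 - s / D) / 2 + ((- 9 * x\<^sup>2 - 5 * s\<^sup>2) / 6 * s * D\<^sup>2
            - (2 * x ^ 3 - 5 * D * x) / 6 * s * (4 * x * D)) / (D\<^sup>2 * D\<^sup>2)
        = s * (- 3 * D\<^sup>2 + (- 9 * x\<^sup>2 - 5 * s\<^sup>2) * D - 4 * x * (2 * x ^ 3 - 5 * D * x)) / (6 * D ^ 3)"
      using D by (simp add: field_simps) (simp add: eval_nat_numeral algebra_simps)
    also have "- 3 * D\<^sup>2 + (- 9 * x\<^sup>2 - 5 * s\<^sup>2) * D - 4 * x * (2 * x ^ 3 - 5 * D * x) = - 8 * s ^ 4"
      by (simp add: D_def eval_nat_numeral algebra_simps)
    also have "s * (- 8 * s ^ 4) / (6 * D ^ 3) = - 4 * s ^ 5 / (3 * D ^ 3)"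
      by (simp add: eval_nat_numeral)
    finally show ?thesis by (simp add: D_def)
  qed
  have eq: "(\<lambda>b. V2 a X b / (a_prime a X b)\<^sup>2) = (\<lambda>b. w (X - b / 2))"
  proof
    fix b
    have "a_prime a X b = (X - b / 2)\<^sup>2 + s\<^sup>2"
      by (simp add: a_prime_eq s X_prime_def)
    thus "V2 a X b / (a_prime a X b)\<^sup>2 = w (X - b / 2)"
      using nz[of "X - b / 2"]
      by (simp add: V2_def w_def X_prime_def s_def[symmetric] add_divide_distrib)
  qed
  have "((\<lambda>b. w (X - b / 2)) has_real_derivative
      (- 4 * s ^ 5 / (3 * ((X - b / 2)\<^sup>2 + s\<^sup>2) ^ 3)) * (- 1 / 2)) (at b)"
    by (rule DERIV_chain2[OF dw]) (auto intro!: derivative_eq_intros)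
  moreover have "A_par a X powr (5 / 2) = s ^ 5"
    by (simp add: A_powr s_def)
  moreover have "a_prime a X b = (X - b / 2)\<^sup>2 + s\<^sup>2"
    by (simp add: a_prime_eq X_prime_def s(2))
  ultimately show ?thesis
    unfolding eq by simp
qed

lemma V2_normalised_tendsto_0: "((\<lambda>b. V2 a X b / (a_prime a X b)\<^sup>2) \<longlongrightarrow> 0) at_bot"
proof -
  define s where "s = sqrt (A_par a X)"
  have s: "s > 0" using A_pos by (auto simp: s_def)
  have "((\<lambda>b. (pi / 2 - arctan (X_prime X b / s)) / 2) \<longlongrightarrow> (pi / 2 - pi / 2) / 2) at_bot"
  proof (intro tendsto_intros filterlim_compose[OF tendsto_arctan_at_top])
    show "filterlim (\<lambda>b. X_prime X b / s) at_top at_bot"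
      unfolding X_prime_def using s by real_asymp
  qed simp
  moreover have "((\<lambda>b. (2 * X_prime X b ^ 3 - 5 * a_prime a X b * X_prime X b) / 6 * s
      / (a_prime a X b)\<^sup>2) \<longlongrightarrow> 0) at_bot"
    unfolding X_prime_def a_prime_def using s by real_asymp
  ultimately have "((\<lambda>b. (pi / 2 - arctan (X_prime X b / s)) / 2
      + (2 * X_prime X b ^ 3 - 5 * a_prime a X b * X_prime X b) / 6 * s
        / (a_prime a X b)\<^sup>2) \<longlongrightarrow> 0) at_bot"
    (is "(?f \<longlongrightarrow> _) _")
    using tendsto_add by fastforce
  moreover have "(\<lambda>b. V2 a X b / (a_prime a X b)\<^sup>2) = ?f"
    using a_prime_pos
    by (auto simp: V2_def s_def add_divide_distrib fun_eq_iff less_imp_neq[symmetric])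
  ultimately show ?thesis by simp
qed

lemma V2_pos: "V2 a X b > 0"
proof -
  have "V2 a X b / (a_prime a X b)\<^sup>2 > 0"
  proof (rule pos_if_increasing_from_zero_at_bot[OF V2_normalised_tendsto_0])
    show "continuous_on {..b} (\<lambda>b. V2 a X b / (a_prime a X b)\<^sup>2)"
      by (rule DERIV_continuous_on, rule has_field_derivative_at_within)
         (rule has_real_derivative_V2_normalised)
    show "\<exists>y. ((\<lambda>b. V2 a X b / (a_prime a X b)\<^sup>2) has_real_derivative y) (at x) \<and> y > 0" for x
      by (intro exI conjI, rule has_real_derivative_V2_normalised)
         (use A_pos a_prime_pos[of x] in simp)
  qed
  thus ?thesis using a_prime_pos[of b] by (simp add: zero_less_divide_iff)
qed

lemma E_zero_pos: "E a X 0 > 0"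
  using V2_pos by (simp add: E_def)

lemma E_neg_if_q_nonpos: "b < 0 \<Longrightarrow> q X b \<le> 0 \<Longrightarrow> E a X b < 0"
  using V2_pos[of b] A_pos unfolding E_eq
  by (intro add_nonpos_neg mult_nonpos_nonneg mult_neg_pos) auto

lemma sgn_G: "q X b > 0 \<Longrightarrow> sgn (G a X b) = sgn (E a X b)"
  using a_prime_pos[of b] by (simp add: G_def sgn_divide sgn_mult)

lemma G_eq:
  "q X b \<noteq> 0 \<Longrightarrow> G a X b = V2 a X b / (a_prime a X b)\<^sup>2
     + 2 / 9 * A_par a X powr (5 / 2) * (b / (q X b * (a_prime a X b)\<^sup>2))"
  using a_prime_pos[of b] unfolding G_def E_eq by (simp add: add_divide_distrib)

text \<open>
  The derivative of \<open>V\<^sub>2 / a'\<^sup>2\<close> is already a multiple of \<open>1 / a'\<^sup>3\<close>, and so is that of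
  \<open>b / (q a'\<^sup>2)\<close> up to \<open>q\<^sup>2\<close>. In the common numerator the terms of degree four cancel, which leaves the
  cubic \<open>P\<close>.
\<close>

lemma has_real_derivative_G:
  assumes "q X b \<noteq> 0"
  shows "(G a X has_real_derivative
     A_par a X powr (5 / 2) * P a X b / (108 * a_prime a X b ^ 3 * (q X b)\<^sup>2)) (at b)"
proof -
  define K where "K = A_par a X powr (5 / 2)"
  have cont: "continuous_on UNIV (q X)"
    unfolding q_def[abs_def] divide_inverse by (intro continuous_intros)
  have dq: "(q X has_real_derivative 5 * b / 6 - 2 * X / 3) (at b)"
    unfolding q_def[abs_def] by (auto intro!: derivative_eq_intros)
  have da: "(a_prime a X has_real_derivative b / 2 - X) (at b)"
    unfolding a_prime_def[abs_def] by (auto intro!: derivative_eq_intros)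
  have pos: "a_prime a X b \<noteq> 0" using a_prime_pos[of b] by simp
  have frac: "((\<lambda>b. b / (q X b * (a_prime a X b)\<^sup>2)) has_real_derivative
      (q X b * a_prime a X b - b * ((5 * b / 6 - 2 * X / 3) * a_prime a X b
          + 2 * q X b * (b / 2 - X))) / ((q X b)\<^sup>2 * a_prime a X b ^ 3)) (at b)"
    (is "(_ has_real_derivative ?D) _")
  proof -
    have den: "((\<lambda>b. q X b * (a_prime a X b)\<^sup>2) has_real_derivative
        (5 * b / 6 - 2 * X / 3) * (a_prime a X b)\<^sup>2
          + 2 * a_prime a X b * (b / 2 - X) * q X b) (at b)"
      by (rule DERIV_cong[OF DERIV_mult[OF dq DERIV_power[OF da, of 2]]]) simp
    have "((\<lambda>b. b / (q X b * (a_prime a X b)\<^sup>2)) has_real_derivative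
        (1 * (q X b * (a_prime a X b)\<^sup>2) - b * ((5 * b / 6 - 2 * X / 3) * (a_prime a X b)\<^sup>2
          + 2 * a_prime a X b * (b / 2 - X) * q X b))
        / ((q X b * (a_prime a X b)\<^sup>2) * (q X b * (a_prime a X b)\<^sup>2))) (at b)"
      by (rule DERIV_divide[OF DERIV_ident den]) (use pos assms in simp)
    also have "(1 * (q X b * (a_prime a X b)\<^sup>2) - b * ((5 * b / 6 - 2 * X / 3) * (a_prime a X b)\<^sup>2
          + 2 * a_prime a X b * (b / 2 - X) * q X b))
        = a_prime a X b * (q X b * a_prime a X b - b * ((5 * b / 6 - 2 * X / 3) * a_prime a X b
          + 2 * q X b * (b / 2 - X)))"
      by (simp add: power2_eq_square algebra_simps)
    also have "\<dots> / ((q X b * (a_prime a X b)\<^sup>2) * (q X b * (a_prime a X b)\<^sup>2)) = ?D"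
      using pos assms by (simp add: power2_eq_square power3_eq_cube)
    finally show ?thesis .
  qed
  have c1: "1 / 2 - 5 * b\<^sup>2 / 12 = q X b - b * (5 * b / 6 - 2 * X / 3)"
    and c2: "b\<^sup>2 / 4 + 3 / 2 = 3 * q X b - 2 * b * (b / 2 - X)"
    by (simp_all add: q_def power2_eq_square field_simps)
  have P: "P a X b = 24 * (3 * (q X b)\<^sup>2 + (q X b * a_prime a X b
      - b * ((5 * b / 6 - 2 * X / 3) * a_prime a X b + 2 * q X b * (b / 2 - X))))"
    unfolding P_eq_q c1 c2 by (simp add: power2_eq_square algebra_simps)
  have "((\<lambda>b. V2 a X b / (a_prime a X b)\<^sup>2
     + 2 / 9 * K * (b / (q X b * (a_prime a X b)\<^sup>2))) has_real_derivative
       K * P a X b / (108 * a_prime a X b ^ 3 * (q X b)\<^sup>2)) (at b)"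
    by (rule DERIV_cong[OF DERIV_add[OF has_real_derivative_V2_normalised[folded K_def]
            DERIV_cmult[OF frac]]])
       (use pos assms in \<open>simp add: P field_simps\<close>)
  moreover have "eventually (\<lambda>b. q X b \<noteq> 0) (nhds b)"
    using open_vimage[of "- {0}" "q X"] cont assms eventually_nhds
    by (intro eventually_nhds[THEN iffD2] exI[of _ "q X -` (- {0})"]) auto
  hence "eventually (\<lambda>b. G a X b = V2 a X b / (a_prime a X b)\<^sup>2
     + 2 / 9 * K * (b / (q X b * (a_prime a X b)\<^sup>2))) (nhds b)"
    by eventually_elim (simp add: G_eq K_def)
  ultimately show ?thesis
    unfolding K_def by (subst DERIV_cong_ev[OF refl _ refl])
qed

lemma G_tendsto_0: "(G a X \<longlongrightarrow> 0) at_bot"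
proof -
  have "((\<lambda>b. b / (q X b * (a_prime a X b)\<^sup>2)) \<longlongrightarrow> 0) at_bot"
    unfolding q_def a_prime_def by real_asymp
  from tendsto_add[OF V2_normalised_tendsto_0
      tendsto_mult[OF tendsto_const[of "2 / 9 * A_par a X powr (5 / 2)"] this]]
  have lim: "((\<lambda>b. V2 a X b / (a_prime a X b)\<^sup>2
     + 2 / 9 * A_par a X powr (5 / 2) * (b / (q X b * (a_prime a X b)\<^sup>2))) \<longlongrightarrow> 0) at_bot"
    by simp
  have "filterlim (q X) at_top at_bot"
    unfolding q_def[abs_def] by real_asymp
  hence "eventually (\<lambda>b. q X b > 0) at_bot"
    by (simp add: filterlim_at_top_dense)
  hence "eventually (\<lambda>b. V2 a X b / (a_prime a X b)\<^sup>2
     + 2 / 9 * A_par a X powr (5 / 2) * (b / (q X b * (a_prime a X b)\<^sup>2)) = G a X b) at_bot"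
    by eventually_elim (simp add: G_eq)
  with lim show ?thesis by (rule Lim_transform_eventually)
qed

lemma continuous_on_G:
  assumes "\<And>x. x \<in> S \<Longrightarrow> q X x > 0"
  shows "continuous_on S (G a X)"
  by (rule DERIV_continuous_on, rule has_field_derivative_at_within, rule has_real_derivative_G)
     (use assms in force)

section \<open>How the sign of P controls the sign of E\<close>

lemma G_derivative_sign:
  assumes "q X x > 0"
  shows "\<exists>y. (G a X has_real_derivative y) (at x) \<and> sgn y = sgn (P a X x)"
proof (intro exI conjI)
  show "(G a X has_real_derivative
     A_par a X powr (5 / 2) * P a X x / (108 * a_prime a X x ^ 3 * (q X x)\<^sup>2)) (at x)"
    using assms by (intro has_real_derivative_G) simp
qed (use assms A_pos a_prime_pos[of x] in \<open>simp add: sgn_mult sgn_divide\<close>)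

lemma E_pos_if_P_pos_below:
  assumes "\<And>x. x \<le> v \<Longrightarrow> q X x > 0" and "\<And>x. x < v \<Longrightarrow> P a X x > 0"
  shows "E a X v > 0"
proof -
  have "G a X v > 0"
  proof (rule pos_if_increasing_from_zero_at_bot[OF G_tendsto_0])
    show "continuous_on {..v} (G a X)"
      using assms by (intro continuous_on_G) auto
    show "\<exists>y. (G a X has_real_derivative y) (at x) \<and> y > 0" if "x < v" for x
      using G_derivative_sign[of x] assms(1)[of x] assms(2)[of x] that by (auto simp: sgn_1_pos)
  qed
  thus ?thesis using sgn_G[of v] assms(1)[of v] by (simp add: sgn_1_pos)
qed

lemma E_neg_if_P_neg_below:
  assumes "\<And>x. x \<le> v \<Longrightarrow> q X x > 0" and "\<And>x. x < v \<Longrightarrow> P a X x < 0"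
  shows "E a X v < 0"
proof -
  have "- G a X v > 0"
  proof (rule pos_if_increasing_from_zero_at_bot[where f = "\<lambda>x. - G a X x"])
    show "((\<lambda>x. - G a X x) \<longlongrightarrow> 0) at_bot"
      using tendsto_minus[OF G_tendsto_0] by simp
    show "continuous_on {..v} (\<lambda>x. - G a X x)"
      using assms by (intro continuous_on_minus continuous_on_G) auto
    show "\<exists>y. ((\<lambda>x. - G a X x) has_real_derivative y) (at x) \<and> y > 0" if "x < v" for x
    proof -
      obtain y where y: "(G a X has_real_derivative y) (at x)" "sgn y = sgn (P a X x)"
        using G_derivative_sign[of x] assms(1)[of x] \<open>x < v\<close> by auto
      hence "y < 0" using assms(2)[OF \<open>x < v\<close>] by (simp add: sgn_1_neg)
      thus ?thesis using DERIV_minus[OF y(1)] by force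
    qed
  qed
  thus ?thesis using sgn_G[of v] assms(1)[of v] by (simp add: sgn_if split: if_splits)
qed

lemma G_strict_if_P_pos:
  assumes "u < v" and q: "\<And>x. u \<le> x \<Longrightarrow> x \<le> v \<Longrightarrow> q X x > 0"
    and P: "\<And>x. u < x \<Longrightarrow> x < v \<Longrightarrow> P a X x > 0"
  shows "G a X u < G a X v"
proof (rule DERIV_pos_imp_increasing_open[OF \<open>u < v\<close>])
  show "\<exists>y. (G a X has_real_derivative y) (at x) \<and> y > 0" if "u < x" "x < v" for x
    using G_derivative_sign[of x] q[of x] P[of x] that by (auto simp: sgn_1_pos)
qed (use q in \<open>auto intro: continuous_on_G\<close>)

lemma G_strict_if_P_neg:
  assumes "u < v" and q: "\<And>x. u \<le> x \<Longrightarrow> x \<le> v \<Longrightarrow> q X x > 0"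
    and P: "\<And>x. u < x \<Longrightarrow> x < v \<Longrightarrow> P a X x < 0"
  shows "G a X u > G a X v"
proof (rule DERIV_neg_imp_decreasing_open[OF \<open>u < v\<close>])
  show "\<exists>y. (G a X has_real_derivative y) (at x) \<and> y < 0" if "u < x" "x < v" for x
    using G_derivative_sign[of x] q[of x] P[of x] that by (auto simp: sgn_1_neg)
qed (use q in \<open>auto intro: continuous_on_G\<close>)

lemma G_mono_if_P_nonneg:
  assumes "u \<le> v" and q: "\<And>x. u \<le> x \<Longrightarrow> x \<le> v \<Longrightarrow> q X x > 0"
    and P: "\<And>x. u \<le> x \<Longrightarrow> x \<le> v \<Longrightarrow> P a X x \<ge> 0"
  shows "G a X u \<le> G a X v"
proof (rule DERIV_nonneg_imp_nondecreasing[OF \<open>u \<le> v\<close>])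
  fix x assume x: "u \<le> x" "x \<le> v"
  obtain y where "(G a X has_real_derivative y) (at x)" "sgn y = sgn (P a X x)"
    using G_derivative_sign[OF q[OF x]] by blast
  moreover from this have "y \<ge> 0" using P[OF x] by (simp add: sgn_if split: if_splits)
  ultimately show "\<exists>y. (G a X has_real_derivative y) (at x) \<and> y \<ge> 0" by blast
qed

text \<open>
  Positivity of \<open>q\<close> is only demanded in the open interval, because the intervals of interest may end
  at a zero of \<open>q\<close>: existence comes from the continuity of \<open>E\<close> up to the endpoints, uniqueness from the
  strict monotonicity of \<open>G\<close> between two interior zeros.
\<close>

lemma E_unique_zero_between:
  assumes "u < v" and q: "\<And>x. u < x \<Longrightarrow> x < v \<Longrightarrow> q X x > 0"
    and P: "(\<forall>x\<in>{u<..<v}. P a X x > 0) \<or> (\<forall>x\<in>{u<..<v}. P a X x < 0)"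
    and sign: "E a X u * E a X v < 0"
  shows "\<exists>s\<in>{u<..<v}. \<forall>b\<in>{u..v}. E a X b = 0 \<longleftrightarrow> b = s"
proof -
  have nz: "E a X u \<noteq> 0" "E a X v \<noteq> 0" using sign by auto
  have "\<exists>s\<ge>u. s \<le> v \<and> E a X s = 0"
  proof (cases "E a X u < 0")
    case True
    hence "E a X v > 0" using sign by (simp add: mult_less_0_iff)
    thus ?thesis
      using True \<open>u < v\<close> by (intro IVT' continuous_on_E) auto
  next
    case False
    hence "E a X u > 0" "E a X v < 0" using sign by (auto simp: mult_less_0_iff)
    thus ?thesis
      using \<open>u < v\<close> by (intro IVT2' continuous_on_E) auto
  qed
  then obtain s where s: "u \<le> s" "s \<le> v" "E a X s = 0" by blast
  have s': "u < s" "s < v" using s nz by (auto simp: order.order_iff_strict)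
  have no: False if "x < y" "u < x" "y < v" "E a X x = 0" "E a X y = 0" for x y
  proof -
    have "G a X x = G a X y" using that by (simp add: G_def)
    thus False
      using P G_strict_if_P_pos[of x y] G_strict_if_P_neg[of x y] that q by fastforce
  qed
  show ?thesis
  proof (intro bexI[of _ s] ballI iffI)
    fix b assume "b \<in> {u..v}" "E a X b = 0"
    moreover from this nz have "u < b" "b < v" by (auto simp: order.order_iff_strict)
    ultimately show "b = s" using no[of b s] no[of s b] s s' by (cases b s rule: linorder_cases) auto
  qed (use s s' in auto)
qed

end

section \<open>The sign of P on the negative axis\<close>

lemma P_zero_pos: "a > 0 \<Longrightarrow> P a X 0 > 0"
  by (simp add: P_def)

lemma P_at_bot_if_X_neg: "X < 0 \<Longrightarrow> filterlim (P a X) at_top at_bot"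
  unfolding P_def[abs_def] by real_asymp

lemma P_at_bot_if_X_pos: "X > 0 \<Longrightarrow> filterlim (P a X) at_bot at_bot"
  unfolding P_def[abs_def] by real_asymp

lemma P_at_bot_if_X_zero: "a > 21 / 10 \<Longrightarrow> filterlim (P a 0) at_bot at_bot"
  unfolding P_def[abs_def] by real_asymp

text \<open>
  On the negative axis \<open>P b / b\<^sup>2\<close> is strictly increasing when \<open>X \<ge> 0\<close>. Subtracting its values at
  \<open>b\<close> and at the zero \<open>r\<close> and clearing denominators makes the factor \<open>b - r\<close> explicit, with a positive
  cofactor \<open>F\<close>.
\<close>

lemma P_sign_if_X_nonneg:
  assumes "a > 0" "X \<ge> 0" "r < 0" "P a X r = 0" "b < 0"
  shows "sgn (P a X b) = sgn (b - r)"
proof -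
  define F where "F = 6 * X * b\<^sup>2 * r\<^sup>2 + 36 * X * (b * r) - (12 * a + 18) * (r + b)"
  have "P a X b * r\<^sup>2 = P a X b * r\<^sup>2 - P a X r * b\<^sup>2" using assms by simp
  also have "\<dots> = (b - r) * F"
    by (simp add: P_def F_def power2_eq_square power3_eq_cube algebra_simps)
  finally have eq: "P a X b * r\<^sup>2 = (b - r) * F" .
  have "(12 * a + 18) * (r + b) < 0" using assms by (intro mult_pos_neg) auto
  moreover have "36 * X * (b * r) \<ge> 0" using assms by (simp add: mult_nonpos_nonpos)
  moreover have "6 * X * b\<^sup>2 * r\<^sup>2 \<ge> 0" using assms by simp
  ultimately have "F > 0" by (simp add: F_def)
  hence "sgn (P a X b * r\<^sup>2) = sgn (b - r)" by (simp add: eq sgn_mult)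
  thus ?thesis using assms by (simp add: sgn_mult)
qed

text \<open>
  Divide \<open>P\<close> by \<open>(b - r1) (b - r2)\<close>: the linear remainder vanishes at two points and is zero, and the
  linear quotient \<open>6 X b + m\<close> is positive for \<open>b < 0\<close>, since comparing constant terms gives
  \<open>m r1 r2 = 12 a + 18 > 0\<close>.
\<close>

lemma P_sign_if_X_neg:
  assumes "a > 0" "X < 0" "r1 < r2" "r2 < 0" "P a X r1 = 0" "P a X r2 = 0" "b < 0"
  shows "sgn (P a X b) = sgn ((b - r1) * (b - r2))"
proof -
  define m where "m = 21 - 10 * a + 6 * X * (r1 + r2)"
  define \<alpha> where "\<alpha> = - 36 * X + m * (r1 + r2) - 6 * X * (r1 * r2)"
  define \<beta> where "\<beta> = 12 * a + 18 - m * (r1 * r2)"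
  have eq: "P a X x = (x - r1) * (x - r2) * (6 * X * x + m) + (\<alpha> * x + \<beta>)" for x
    by (simp add: P_def \<alpha>_def \<beta>_def m_def power2_eq_square power3_eq_cube algebra_simps)
  have "\<alpha> * r1 + \<beta> = 0" "\<alpha> * r2 + \<beta> = 0"
    using eq[of r1] eq[of r2] assms by auto
  hence "\<alpha> * (r2 - r1) = 0" unfolding right_diff_distrib by linarith
  hence \<alpha>: "\<alpha> = 0" using assms by simp
  hence \<beta>: "\<beta> = 0" using \<open>\<alpha> * r1 + \<beta> = 0\<close> by simp
  have "m * (r1 * r2) > 0" using \<beta> assms by (simp add: \<beta>_def)
  moreover have "r1 * r2 > 0" using assms by (intro mult_neg_neg) auto
  ultimately have "m > 0" by (simp add: zero_less_mult_iff)
  moreover have "X * b > 0" using assms by (intro mult_neg_neg) auto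
  ultimately have "6 * X * b + m > 0" by simp
  thus ?thesis by (simp add: eq \<alpha> \<beta> sgn_mult)
qed

lemma P_pos_left_of_zeros:
  assumes "a > 0" "X < 0" "r1 < r2" "r2 < 0" "P a X r1 = 0" "P a X r2 = 0"
    and "x < r1"
  shows "P a X x > 0"
proof -
  have "(x - r1) * (x - r2) > 0" using assms by (intro mult_neg_neg) auto
  thus ?thesis
    using P_sign_if_X_neg[of a X r1 r2 x] assms by (simp add: sgn_if split: if_splits)
qed

lemma P_neg_between_zeros:
  assumes "a > 0" "X < 0" "r1 < r2" "r2 < 0" "P a X r1 = 0" "P a X r2 = 0"
    and "r1 < x" "x < r2"
  shows "P a X x < 0"
proof -
  have "(x - r1) * (x - r2) < 0" using assms by (intro mult_pos_neg) auto
  thus ?thesis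
    using P_sign_if_X_neg[of a X r1 r2 x] assms by (simp add: sgn_if split: if_splits)
qed

lemma P_pos_right_of_zeros:
  assumes "a > 0" "X < 0" "r1 < r2" "r2 < 0" "P a X r1 = 0" "P a X r2 = 0"
    and "r2 < x" "x < 0"
  shows "P a X x > 0"
proof -
  have "(x - r1) * (x - r2) > 0" using assms by (intro mult_pos_pos) auto
  thus ?thesis
    using P_sign_if_X_neg[of a X r1 r2 x] assms by (simp add: sgn_if split: if_splits)
qed

text \<open>
  Since \<open>P\<close> is positive near minus infinity and at \<open>0\<close>, a single negative value at \<open>c\<close> produces a zero
  on either side of \<open>c\<close>; by the sign pattern there are no others.
\<close>

lemma P_neg_zeros_if_X_neg:
  assumes "a > 0" "X < 0" "c < 0" "P a X c < 0"
  shows "\<exists>r1 r2. r1 < c \<and> c < r2 \<and> r2 < 0 \<and> P_neg_zeros a X = {r1, r2}"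
proof -
  have "eventually (\<lambda>x. P a X x > 0 \<and> x < c) at_bot"
    using P_at_bot_if_X_neg[OF assms(2), of a] eventually_gt_at_bot[of c]
    by (intro eventually_conj) (auto simp: filterlim_at_top_dense)
  then obtain u where u: "P a X u > 0" "u < c"
    by (auto dest!: eventually_happens)
  obtain r1 where r1: "u \<le> r1" "r1 \<le> c" "P a X r1 = 0"
    using IVT2'[of "P a X" c 0 u] u assms continuous_on_P by force
  obtain r2 where r2: "c \<le> r2" "r2 \<le> 0" "P a X r2 = 0"
    using IVT'[of "P a X" c 0 0] assms continuous_on_P P_zero_pos[of a X] by force
  have *: "r1 < c" "c < r2" "r2 < 0"
    using r1 r2 assms P_zero_pos[of a X] by (auto simp: order.order_iff_strict)
  have "b = r1 \<or> b = r2" if "b < 0" "P a X b = 0" for b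
    using P_sign_if_X_neg[of a X r1 r2 b] assms that * r1 r2 by (auto simp: sgn_mult sgn_zero_iff)
  hence "P_neg_zeros a X = {r1, r2}"
    using r1 r2 * by (auto simp: P_neg_zeros_def)
  thus ?thesis using * by blast
qed

section \<open>Counting the solutions\<close>

text \<open>
  The limit hypothesis is what distinguishes the cases with a solution: it holds for \<open>X > 0\<close>, and for
  \<open>X = 0\<close> exactly when the coefficient \<open>21 - 10 a\<close> is negative.
\<close>

lemma unique_solution_if_X_nonneg:
  assumes "X\<^sup>2 < a" "X \<ge> 0" and lim: "filterlim (P a X) at_bot at_bot"
  shows "\<exists>r. P_neg_zeros a X = {r} \<and> (\<exists>s. E_solutions a X = {s} \<and> s \<in> {r<..<0})"
proof -
  have a: "a > 0" using assms(1) by (smt (verit) zero_le_power2)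
  have "eventually (\<lambda>x. P a X x < 0 \<and> x < 0) at_bot"
    using lim eventually_gt_at_bot[of "0::real"]
    by (intro eventually_conj) (auto simp: filterlim_at_bot_dense)
  then obtain u where u: "P a X u < 0" "u < 0"
    by (auto dest!: eventually_happens)
  obtain r where "u \<le> r" "r \<le> 0" "P a X r = 0"
    using IVT'[of "P a X" u 0 0] u continuous_on_P P_zero_pos[OF a, of X] by force
  hence r: "r < 0" "P a X r = 0"
    using P_zero_pos[OF a, of X] by (auto simp: order.order_iff_strict)
  have sign: "sgn (P a X b) = sgn (b - r)" if "b < 0" for b
    using P_sign_if_X_nonneg[of a X r b] assms a r that by blast
  have zeros: "P_neg_zeros a X = {r}"
    using r sign by (auto simp: P_neg_zeros_def sgn_zero_iff) (metis sgn_0 sgn_zero_iff eq_iff_diff_eq_0)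
  have q: "q X x > 0" if "x \<le> 0" for x
    using q_pos_if_nonneg assms that by blast
  have P_neg: "P a X x < 0" if "x < r" for x
    using sign[of x] that r by (simp add: sgn_if split: if_splits)
  have P_pos: "P a X x > 0" if "r < x" "x < 0" for x
    using sign[of x] that r by (simp add: sgn_if split: if_splits)
  have E_neg: "E a X x < 0" if "x \<le> r" for x
    using that q P_neg r by (intro E_neg_if_P_neg_below assms(1)) auto
  obtain s where s: "s \<in> {r<..<0}" "\<forall>b\<in>{r..0}. E a X b = 0 \<longleftrightarrow> b = s"
    using E_unique_zero_between[OF assms(1), of r 0] r q P_pos E_neg[of r] E_zero_pos[OF assms(1)]
    by (force simp: mult_less_0_iff)
  have "E_solutions a X = {s}"
  proof (intro set_eqI iffI)
    fix b assume "b \<in> E_solutions a X"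
    hence b: "b < 0" "E a X b = 0" by (auto simp: E_solutions_def)
    hence "r < b" using E_neg[of b] by force
    thus "b \<in> {s}" using b s by auto
  next
    fix b assume "b \<in> {s}"
    thus "b \<in> E_solutions a X" using s by (auto simp: E_solutions_def)
  qed
  thus ?thesis using zeros s by blast
qed

text \<open>
  A double zero of \<open>P\<close> must not spoil strictness. Far to the left \<open>P > 0\<close>, so \<open>G\<close> is already positive
  there, and afterwards it does not decrease.
\<close>

lemma E_pos_if_P_nonneg_below:
  assumes "X\<^sup>2 < a" "X < 0" and q: "\<And>x. x \<le> v \<Longrightarrow> q X x > 0"
    and P: "\<And>x. x \<le> v \<Longrightarrow> P a X x \<ge> 0"
  shows "E a X v > 0"
proof -
  have "eventually (\<lambda>x. P a X x > 0) at_bot"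
    using P_at_bot_if_X_neg[OF assms(2), of a] by (auto simp: filterlim_at_top_dense)
  then obtain u where u: "P a X x > 0" if "x \<le> u" for x
    by (auto simp: eventually_at_bot_linorder)
  define w where "w = min u v"
  have "E a X w > 0"
    using u q by (intro E_pos_if_P_pos_below assms(1)) (auto simp: w_def)
  hence "G a X w > 0"
    using sgn_G[OF assms(1), of w] q[of w] by (auto simp: w_def sgn_if split: if_splits)
  also have "G a X w \<le> G a X v"
    using q P by (intro G_mono_if_P_nonneg assms(1)) (auto simp: w_def)
  finally show ?thesis
    using sgn_G[OF assms(1), of v] q[of v] by (auto simp: sgn_if split: if_splits)
qed

text \<open>
  Here \<open>q > 0\<close> everywhere, so \<open>G\<close> is smooth on the whole line. A solution forces \<open>P\<close> to be negative
  somewhere, since otherwise \<open>G\<close> would grow from its limit \<open>0\<close>. Given the two zeros of \<open>P\<close>,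
  \<open>G\<close> is positive up to the smaller one and has a strict minimum over the remaining interval at the
  larger one.
\<close>

lemma solutions_if_X_between:
  assumes inside: "X\<^sup>2 < a" and X: "- sqrt (15 / 8) < X" "X < 0"
  shows "(E_solutions a X \<noteq> {} \<longrightarrow> (\<exists>bt1 bt2. bt1 < bt2 \<and> P_neg_zeros a X = {bt1, bt2})) \<and>
        (\<forall>bt1 bt2. bt1 < bt2 \<and> P_neg_zeros a X = {bt1, bt2} \<longrightarrow>
           (E a X bt2 = 0 \<longrightarrow> E_solutions a X = {bt2}) \<and>
           (E a X bt2 < 0 \<longrightarrow>
              (\<exists>s1 s2. s1 \<noteq> s2 \<and> E_solutions a X = {s1, s2} \<and>
                 s1 \<in> {bt1<..<bt2} \<and> s2 \<in> {bt2<..<0})) \<and>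
           (E a X bt2 > 0 \<longrightarrow> E_solutions a X = {}))"
proof (intro conjI impI allI; (elim conjE)?)
  have a: "a > 0" using assms(1) by (smt (verit) zero_le_power2)
  have "\<bar>X\<bar> < sqrt (15 / 8)" using X by simp
  hence "X\<^sup>2 < 15 / 8"
    using real_less_rsqrt real_sqrt_abs real_sqrt_less_iff by metis
  hence q: "q X x > 0" for x by (rule q_pos_if_small)
  {
    assume "E_solutions a X \<noteq> {}"
    then obtain b where b: "b < 0" "E a X b = 0" by (auto simp: E_solutions_def)
    hence "\<exists>c\<le>b. P a X c < 0"
      using E_pos_if_P_nonneg_below[OF inside X(2), of b] q by (force simp: not_less)
    thus "\<exists>bt1 bt2. bt1 < bt2 \<and> P_neg_zeros a X = {bt1, bt2}"
      using P_neg_zeros_if_X_neg[OF a X(2)] b by (meson order.strict_trans order.strict_trans1)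
  }
  fix r1 r2 assume r: "r1 < r2" and "P_neg_zeros a X = {r1, r2}"
  hence r': "r2 < 0" "P a X r1 = 0" "P a X r2 = 0"
    by (auto simp: P_neg_zeros_def set_eq_iff)
  note P1 = P_pos_left_of_zeros[OF a X(2) r r']
    and P2 = P_neg_between_zeros[OF a X(2) r r']
    and P3 = P_pos_right_of_zeros[OF a X(2) r r']
  have E1: "E a X x > 0" if "x \<le> r1" for x
    using that q P1 by (intro E_pos_if_P_pos_below inside) auto
  have E_pos: "E a X x > 0" if "G a X r2 \<ge> 0" "x < 0" "x \<noteq> r2" for x
  proof (cases "x \<le> r1")
    case True
    thus ?thesis by (rule E1)
  next
    case False
    hence "r1 < x" by simp
    have "G a X x > G a X r2"
    proof (cases "x < r2")
      case True
      thus ?thesis using that \<open>r1 < x\<close> q P2 by (intro G_strict_if_P_neg inside) auto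
    next
      case False
      thus ?thesis using that \<open>r1 < x\<close> q P3 by (intro G_strict_if_P_pos inside) auto
    qed
    thus ?thesis using that sgn_G[OF inside q, of x] by (auto simp: sgn_if split: if_splits)
  qed
  have sg: "sgn (G a X r2) = sgn (E a X r2)" using sgn_G[OF inside q] .
  show "E_solutions a X = {r2}" if "E a X r2 = 0"
  proof -
    have "G a X r2 = 0" using that by (simp add: G_def)
    thus ?thesis using E_pos r' that by (auto simp: E_solutions_def less_le)
  qed
  show "E_solutions a X = {}" if "E a X r2 > 0"
  proof -
    have "G a X r2 \<ge> 0" using that sg by (auto simp: sgn_if split: if_splits)
    thus ?thesis using E_pos that by (auto simp: E_solutions_def less_le)
  qed
  show "\<exists>s1 s2. s1 \<noteq> s2 \<and> E_solutions a X = {s1, s2} \<and> s1 \<in> {r1<..<r2} \<and> s2 \<in> {r2<..<0}"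
    if neg: "E a X r2 < 0"
  proof -
    obtain s1 where s1: "s1 \<in> {r1<..<r2}" "\<forall>b\<in>{r1..r2}. E a X b = 0 \<longleftrightarrow> b = s1"
      using E_unique_zero_between[OF inside, of r1 r2] r q P2 E1[of r1] neg
      by (force simp: mult_less_0_iff)
    obtain s2 where s2: "s2 \<in> {r2<..<0}" "\<forall>b\<in>{r2..0}. E a X b = 0 \<longleftrightarrow> b = s2"
      using E_unique_zero_between[OF inside, of r2 0] r' q P3 E_zero_pos[OF inside] neg
      by (force simp: mult_less_0_iff)
    have "E_solutions a X = {s1, s2}"
    proof (intro set_eqI iffI)
      fix b assume "b \<in> E_solutions a X"
      hence b: "b < 0" "E a X b = 0" by (auto simp: E_solutions_def)
      hence "r1 < b" using E1[of b] by force
      thus "b \<in> {s1, s2}" using b s1 s2 by (cases "b \<le> r2") auto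
    next
      fix b assume "b \<in> {s1, s2}"
      thus "b \<in> E_solutions a X" using s1 s2 r' by (auto simp: E_solutions_def)
    qed
    moreover have "s1 \<noteq> s2" using s1 s2 by auto
    ultimately show ?thesis using s1(1) s2(1) by blast
  qed
qed

text \<open>
  The zeros of \<open>q\<close> split the negative axis: \<open>E < 0\<close> between them, and the two solutions lie on either
  side, where \<open>E\<close> is positive at the outer end.
\<close>

lemma two_solutions_if_X_below:
  assumes inside: "X\<^sup>2 < a" and X: "X \<le> - sqrt (15 / 8)"
  shows "\<exists>bt1 bt2. bt1 < bt2 \<and> P_neg_zeros a X = {bt1, bt2} \<and> bt1 < b1 X \<and>
           (\<exists>s1 s2. s1 \<noteq> s2 \<and> E_solutions a X = {s1, s2} \<and>
              s1 \<in> {bt1<..<b1 X} \<and> s2 \<in> {b2 X<..<0})"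
proof -
  have a: "a > 0" using assms(1) by (smt (verit) zero_le_power2)
  have "0 < sqrt (15 / 8 :: real)" by simp
  hence X0: "X < 0" using X by linarith
  have X2: "15 / 8 \<le> X\<^sup>2"
  proof -
    have "(sqrt (15 / 8))\<^sup>2 \<le> (- X)\<^sup>2" using X by (intro power_mono) simp_all
    also have "(sqrt (15 / 8))\<^sup>2 = (15 / 8 :: real)" by (rule real_sqrt_pow2) simp
    finally show ?thesis by simp
  qed
  note q_eq = q_factorisation[OF X2]
  have b12: "b1 X \<le> b2 X" using X2 by (simp add: b1_def b2_def)
  have "sqrt (16 * X\<^sup>2 - 30) < sqrt ((4 * X)\<^sup>2)"
    by (intro real_sqrt_less_mono) (simp add: power2_eq_square)
  also have "sqrt ((4 * X)\<^sup>2) = - 4 * X" by (subst real_sqrt_abs) (use X0 in simp)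
  finally have b2: "b2 X < 0" by (simp add: b2_def)
  have b1: "b1 X < 0" using b12 b2 by simp
  have q1: "q X x > 0" if "x < b1 X" for x
    unfolding q_eq using that b12 by (intro mult_neg_neg mult_pos_neg) auto
  have q2: "q X x > 0" if "b2 X < x" for x
    unfolding q_eq using that b12 by (intro mult_pos_pos) auto
  have qm: "q X x \<le> 0" if "b1 X \<le> x" "x \<le> b2 X" for x
    unfolding q_eq using that b12 by (intro mult_nonneg_nonpos mult_nonneg_nonneg) auto
  have E_mid: "E a X x < 0" if "b1 X \<le> x" "x \<le> b2 X" for x
    using that b2 qm[of x] by (intro E_neg_if_q_nonpos[OF inside]) auto
  (* If P were nonnegative left of b1, E would be positive there, hence E b1 >= 0 in the limit.
     This argument also covers b1 = b2, where P vanishes at b1 itself. *)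
  have "\<exists>c<b1 X. P a X c < 0"
  proof (rule ccontr)
    assume "\<not> ?thesis"
    hence P_nonneg: "P a X x \<ge> 0" if "x < b1 X" for x
      using that by (meson not_less)
    have "E a X x > 0" if "x < b1 X" for x
      using that q1 P_nonneg by (intro E_pos_if_P_nonneg_below[OF inside X0]) auto
    moreover have "(E a X \<longlongrightarrow> E a X (b1 X)) (at_left (b1 X))"
      using continuous_on_E[of UNIV a X] 
      by (auto simp: continuous_on_def intro: tendsto_within_subset)
    ultimately have "E a X (b1 X) \<ge> 0"
      by (intro tendsto_lowerbound[of "E a X" _ "at_left (b1 X)"])
         (auto simp: eventually_at_filter less_imp_le)
    thus False using E_mid[of "b1 X"] b12 by simp
  qed
  then obtain c where c: "c < b1 X" "P a X c < 0" by blast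
  then obtain r1 r2 where r: "r1 < c" "c < r2" "r2 < 0" and zeros: "P_neg_zeros a X = {r1, r2}"
    using P_neg_zeros_if_X_neg[OF a X0, of c] b1 by auto
  have r': "P a X r1 = 0" "P a X r2 = 0"
    using zeros by (auto simp: P_neg_zeros_def set_eq_iff)
  have r12: "r1 < r2" using r by simp
  note P1 = P_pos_left_of_zeros[OF a X0 r12 r(3) r']
    and P2 = P_neg_between_zeros[OF a X0 r12 r(3) r']
    and P3 = P_pos_right_of_zeros[OF a X0 r12 r(3) r']
  have q0: "q X (b1 X) = 0" "q X (b2 X) = 0" by (simp_all add: q_eq)
  (* b1 and b2 are negative with product 6/5, so b1^2 >= 6/5 >= b2^2; this places the larger zero
     of P between them. *)
  have prod: "b1 X * b2 X = 6 / 5" using q_eq[of 0] by (simp add: q_def)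
  have "b1 X * b1 X \<ge> b1 X * b2 X" "b2 X * b2 X \<le> b1 X * b2 X"
    using b12 b1 b2 by (auto intro: mult_left_mono_neg mult_right_mono_neg)
  hence sq: "(b1 X)\<^sup>2 \<ge> 6 / 5" "(b2 X)\<^sup>2 \<le> 6 / 5"
    unfolding prod by (simp_all add: power2_eq_square)
  have "P a X (b1 X) \<le> 0" unfolding P_eq_q q0
    using sq(1) a_prime_pos[OF inside, of "b1 X"] by (simp add: mult_nonneg_nonpos)
  hence r2_ge: "b1 X \<le> r2" using P3[of "b1 X"] b1 by force
  have "P a X (b2 X) \<ge> 0" unfolding P_eq_q q0
    using sq(2) a_prime_pos[OF inside, of "b2 X"] by simp
  hence r2_le: "r2 \<le> b2 X" using P2[of "b2 X"] b12 c r by force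
  have E1: "E a X x > 0" if "x \<le> r1" for x
    using that q1 P1 r c by (intro E_pos_if_P_pos_below inside) auto
  obtain s1 where s1: "s1 \<in> {r1<..<b1 X}" "\<forall>b\<in>{r1..b1 X}. E a X b = 0 \<longleftrightarrow> b = s1"
    using E_unique_zero_between[OF inside, of r1 "b1 X"] r c q1 P2 r2_ge E1[of r1] E_mid[of "b1 X"] b12
    by (force simp: mult_less_0_iff)
  obtain s2 where s2: "s2 \<in> {b2 X<..<0}" "\<forall>b\<in>{b2 X..0}. E a X b = 0 \<longleftrightarrow> b = s2"
    using E_unique_zero_between[OF inside, of "b2 X" 0] b2 q2 P3 r2_le E_zero_pos[OF inside] E_mid[of "b2 X"] b12
    by (force simp: mult_less_0_iff)
  have "E_solutions a X = {s1, s2}"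
  proof (intro set_eqI iffI)
    fix b assume "b \<in> E_solutions a X"
    hence b: "b < 0" "E a X b = 0" by (auto simp: E_solutions_def)
    hence "r1 < b" "\<not> (b1 X \<le> b \<and> b \<le> b2 X)" using E1[of b] E_mid[of b] by force+
    thus "b \<in> {s1, s2}" using b s1 s2 by (cases "b \<le> b1 X") auto
  next
    fix b assume "b \<in> {s1, s2}"
    thus "b \<in> E_solutions a X" using s1 s2 b1 by (auto simp: E_solutions_def)
  qed
  moreover have "s1 \<noteq> s2" using s1 s2 b12 by auto
  ultimately have "\<exists>s1 s2. s1 \<noteq> s2 \<and> E_solutions a X = {s1, s2} \<and>
      s1 \<in> {r1<..<b1 X} \<and> s2 \<in> {b2 X<..<0}"
    using s1(1) s2(1) by blast
  moreover have "r1 < r2" "r1 < b1 X" using r c by auto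
  ultimately show ?thesis using zeros by blast
qed

theorem theorem2:
  fixes a X :: real
  assumes "a > 0" and "- sqrt a < X" and "X < sqrt a"
  shows
    "(X \<le> - sqrt (15 / 8) \<longrightarrow>
        (\<exists>bt1 bt2. bt1 < bt2 \<and> P_neg_zeros a X = {bt1, bt2} \<and> bt1 < b1 X \<and>
           (\<exists>s1 s2. s1 \<noteq> s2 \<and> E_solutions a X = {s1, s2} \<and>
              s1 \<in> {bt1<..<b1 X} \<and> s2 \<in> {b2 X<..<0})))
     \<and>
     (- sqrt (15 / 8) < X \<and> X < 0 \<longrightarrow>
        (E_solutions a X \<noteq> {} \<longrightarrow> (\<exists>bt1 bt2. bt1 < bt2 \<and> P_neg_zeros a X = {bt1, bt2})) \<and>
        (\<forall>bt1 bt2. bt1 < bt2 \<and> P_neg_zeros a X = {bt1, bt2} \<longrightarrow>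
           (E a X bt2 = 0 \<longrightarrow> E_solutions a X = {bt2}) \<and>
           (E a X bt2 < 0 \<longrightarrow>
              (\<exists>s1 s2. s1 \<noteq> s2 \<and> E_solutions a X = {s1, s2} \<and>
                 s1 \<in> {bt1<..<bt2} \<and> s2 \<in> {bt2<..<0})) \<and>
           (E a X bt2 > 0 \<longrightarrow> E_solutions a X = {})))
     \<and>
     (X = 0 \<longrightarrow>
        (a \<le> 21 / 10 \<longrightarrow> E_solutions a X = {}) \<and>
        (a > 21 / 10 \<longrightarrow>
           (\<exists>bt1. P_neg_zeros a X = {bt1} \<and>
              (\<exists>s. E_solutions a X = {s} \<and> s \<in> {bt1<..<0}))))
     \<and>
     (X > 0 \<longrightarrow>
        (\<exists>bt1. P_neg_zeros a X = {bt1} \<and>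
           (\<exists>s. E_solutions a X = {s} \<and> s \<in> {bt1<..<0})))"
proof -
  have "\<bar>X\<bar> < sqrt a" using assms by simp
  hence inside: "X\<^sup>2 < a"
    using real_sqrt_abs real_sqrt_less_iff by metis
  have "E_solutions a X = {}" if "X = 0" "a \<le> 21 / 10"
  proof -
    have "P a 0 x > 0" for x
      using that assms(1) by (simp add: P_def add_nonneg_pos)
    hence "E a X b > 0" if "b < 0" for b
      using \<open>X = 0\<close> that by (intro E_pos_if_P_pos_below[OF inside]) (auto simp: q_pos_if_nonneg)
    thus ?thesis by (force simp: E_solutions_def)
  qed
  thus ?thesis
    using two_solutions_if_X_below[OF inside] solutions_if_X_between[OF inside]
      unique_solution_if_X_nonneg[OF inside] P_at_bot_if_X_pos[of X a] P_at_bot_if_X_zero[of a]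
    by (intro conjI impI) auto
qed

end
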